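(* Let $\mathbf{k}=(k_1,\ldots,k_r)$ be an index with $r\ge 2$. For each prime $p$ let $\zeta_p$ be a primitive $p$-th root of unity, and identify $\mathbb{Z}[\zeta_p]/(1-\zeta_p)\mathbb{Z}[\zeta_p]$ with $\mathbb{F}_p$. Then $\omega_p(\mathbf{k};\zeta_p)\in\mathbb{Z}[\zeta_p]$ for every prime $p$, and \[ \left(\omega_p(\mathbf{k};\zeta_p) \bmod (1-\zeta_p)\mathbb{Z}[\zeta_p]\right)_p = \omega_{\mathcal{A}}(\mathbf{k}) \in \mathcal{A}.\]
   Context: An index is a tuple $\mathbf{k}=(k_1,\ldots,k_r)$ of positive integers. Let $\mathcal{A}=\big(\prod_{p}\mathbb{F}_p\big)/\big(\bigoplus_p \mathbb{F}_p\big)$, $p$ running over all primes; elements are written $(a_p)_p$ and two elements are equal iff $a_p=b_p$ for all but finitely many $p$; rationals embed into $\mathcal{A}$ by reducing mod $p$ (and setting $a_p=0$ when $p$ divides the denominator). For $n\in\mathbb{N}$ put $\omega_n(\mathbf{k})=\sum_{m_1+\cdots+m_r=n,\ m_i>0}\prod_{a=1}^r m_a^{-k_a}\in\mathbb{Q}$ and $\omega_{\mathcal{A}}(\mathbf{k})=(\omega_p(\mathbf{k}) \bmod p)_p\in\mathcal{A}$ (for $r\ge2$). With the $q$-integer $[m]=1+q+\cdots+q^{m-1}=\frac{1-q^m}{1-q}$, define $\omega_n(\mathbf{k};q)=\sum_{m_1+\cdots+m_r=n,\ m_i>0}\prod_{a=1}^r \frac{q^{(k_a-1)m_a}}{[m_a]^{k_a}}$;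 for $r\ge2$ each $m_a<n$, so this rational function can be evaluated at a primitive $n$-th root of unity. *)

theory Defs
  imports
    Complex_Main
    "HOL-Algebra.Algebra"
    "HOL-Algebra.Algebraic_Closure_Type"
    "HOL-Number_Theory.Residues"
    "HOL-Number_Theory.Modular_Inverse"
begin

hide_const (open) Divisibility.prime

definition is_index :: "nat list \<Rightarrow> bool" where
  "is_index ks \<longleftrightarrow> (\<forall>k\<in>set ks. 0 < k)"


section \<open>The ring \<open>\<A>\<close>\<close>

definition product_ring :: "'i set \<Rightarrow> ('i \<Rightarrow> ('a, 'm) ring_scheme) \<Rightarrow> ('i \<Rightarrow> 'a) ring" where
  "product_ring I R =
     \<lparr>carrier = (\<Pi>\<^sub>E i\<in>I. carrier (R i)),
      monoid.mult = (\<lambda>x y. \<lambda>i\<in>I. x i \<otimes>\<^bsub>R i\<^esub> y i),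
      monoid.one = (\<lambda>i\<in>I. \<one>\<^bsub>R i\<^esub>),
      ring.zero = (\<lambda>i\<in>I. \<zero>\<^bsub>R i\<^esub>),
      ring.add = (\<lambda>x y. \<lambda>i\<in>I. x i \<oplus>\<^bsub>R i\<^esub> y i)\<rparr>"

definition direct_sum_ideal :: "'i set \<Rightarrow> ('i \<Rightarrow> ('a, 'm) ring_scheme) \<Rightarrow> ('i \<Rightarrow> 'a) set" where
  "direct_sum_ideal I R =
     {x \<in> carrier (product_ring I R). finite {i \<in> I. x i \<noteq> \<zero>\<^bsub>R i\<^esub>}}"

lemma product_ring_simps [simp]:
  "carrier (product_ring I R) = (\<Pi>\<^sub>E i\<in>I. carrier (R i))"
  "x \<otimes>\<^bsub>product_ring I R\<^esub> y = (\<lambda>i\<in>I. x i \<otimes>\<^bsub>R i\<^esub> y i)"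
  "x \<oplus>\<^bsub>product_ring I R\<^esub> y = (\<lambda>i\<in>I. x i \<oplus>\<^bsub>R i\<^esub> y i)"
  "\<one>\<^bsub>product_ring I R\<^esub> = (\<lambda>i\<in>I. \<one>\<^bsub>R i\<^esub>)"
  "\<zero>\<^bsub>product_ring I R\<^esub> = (\<lambda>i\<in>I. \<zero>\<^bsub>R i\<^esub>)"
  by (simp_all add: product_ring_def)

lemma cring_product_ring:
  assumes R: "\<And>i. i \<in> I \<Longrightarrow> cring (R i)"
  shows "cring (product_ring I R)"
proof (rule cringI)
  show "abelian_group (product_ring I R)"
  proof (rule abelian_groupI, goal_cases)
    case (1 x y)
    then show ?case using R by (auto intro!: abelian_monoid.a_closed abelian_group.axioms(1) ring.is_abelian_group cring.axioms(1))
  next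
    case 2
    then show ?case using R by (auto intro!: ring.ring_simprules cring.axioms(1))
  next
    case (3 x y z)
    then show ?case using R by (auto intro!: restrict_ext ring.ring_simprules(7) cring.axioms(1))
  next
    case (4 x y)
    then show ?case using R by (auto intro!: restrict_ext ring.ring_simprules(10) cring.axioms(1))
  next
    case (5 x)
    then show ?case using R by (auto intro!: PiE_ext[of _ I "\<lambda>i. carrier (R i)"] ring.ring_simprules cring.axioms(1) simp: PiE_mem abelian_monoid.l_zero abelian_group.axioms(1) ring.is_abelian_group cring.axioms(1))
  next
    case (6 x)
    then show ?case using R
      by (intro bexI[of _ "\<lambda>i\<in>I. \<ominus>\<^bsub>R i\<^esub> x i"])
        (auto intro!: restrict_ext ring.ring_simprules(3) abelian_group.l_neg ring.is_abelian_group cring.axioms(1))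
  qed
  show "comm_monoid (product_ring I R)"
  proof (rule comm_monoidI, goal_cases)
    case (1 x y)
    then show ?case using R by (auto intro!: ring.ring_simprules(5) cring.axioms(1))
  next
    case 2
    then show ?case using R by (auto intro!: ring.ring_simprules(6) cring.axioms(1))
  next
    case (3 x y z)
    then show ?case using R by (auto intro!: restrict_ext ring.ring_simprules(11) cring.axioms(1))
  next
    case (4 x)
    then show ?case using R by (auto intro!: PiE_ext[of _ I "\<lambda>i. carrier (R i)"] ring.ring_simprules(5,6) monoid.l_one ring.is_monoid cring.axioms(1) simp: PiE_mem)
  next
    case (5 x y)
    then show ?case using R by (auto intro!: restrict_ext cring.cring_simprules(14))
  qed
next
  fix x y z
  assume "x \<in> carrier (product_ring I R)" "y \<in> carrier (product_ring I R)" "z \<in> carrier (product_ring I R)"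
  then show "(x \<oplus>\<^bsub>product_ring I R\<^esub> y) \<otimes>\<^bsub>product_ring I R\<^esub> z =
    (x \<otimes>\<^bsub>product_ring I R\<^esub> z) \<oplus>\<^bsub>product_ring I R\<^esub> (y \<otimes>\<^bsub>product_ring I R\<^esub> z)"
    using R by (auto intro!: restrict_ext ring.ring_simprules(13) cring.axioms(1))
qed

lemma ideal_direct_sum:
  assumes R: "\<And>i. i \<in> I \<Longrightarrow> cring (R i)"
  shows "ideal (direct_sum_ideal I R) (product_ring I R)"
proof -
  interpret P: cring "product_ring I R" using cring_product_ring R by blast
  have mem: "z \<in> direct_sum_ideal I R"
    if "x \<in> direct_sum_ideal I R" "y \<in> direct_sum_ideal I R" "z \<in> carrier (product_ring I R)"
     "\<And>i. i\<in>I \<Longrightarrow> x i = \<zero>\<^bsub>R i\<^esub> \<Longrightarrow> y i = \<zero>\<^bsub>R i\<^esub> \<Longrightarrow> z i = \<zero>\<^bsub>R i\<^esub>" for x y z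
  proof -
    have "finite ({i\<in>I. x i \<noteq> \<zero>\<^bsub>R i\<^esub>} \<union> {i\<in>I. y i \<noteq> \<zero>\<^bsub>R i\<^esub>})"
      using that(1,2) by (auto simp: direct_sum_ideal_def)
    then have "finite {i\<in>I. z i \<noteq> \<zero>\<^bsub>R i\<^esub>}"
      by (rule finite_subset[rotated]) (use that(4) in auto)
    then show ?thesis using that(3) by (simp add: direct_sum_ideal_def)
  qed
  have carr: "x \<in> carrier (product_ring I R)" if "x \<in> direct_sum_ideal I R" for x
    using that by (simp add: direct_sum_ideal_def)
  have minus: "(\<ominus>\<^bsub>product_ring I R\<^esub> x) = (\<lambda>i\<in>I. \<ominus>\<^bsub>R i\<^esub> x i)" if "x \<in> carrier (product_ring I R)" for x
    by (rule P.minus_equality)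
      (use that R in \<open>auto intro!: restrict_ext ring.ring_simprules(3) abelian_group.l_neg ring.is_abelian_group cring.axioms(1)\<close>)
  show ?thesis
  proof (rule idealI, goal_cases)
    case 1 show ?case by (rule P.ring_axioms)
  next
    case 2 show ?case
    proof (rule group.subgroupI[OF P.a_group], goal_cases)
      case 1 then show ?case by (auto simp: direct_sum_ideal_def)
    next
      case 2 then show ?case using P.zero_closed by (auto simp: direct_sum_ideal_def intro!: exI[of _ "\<zero>\<^bsub>product_ring I R\<^esub>"])
    next
      case (3 a)
      then have "\<ominus>\<^bsub>product_ring I R\<^esub> a \<in> direct_sum_ideal I R"
        by (intro mem[OF 3 3] P.a_inv_closed[OF carr[OF 3]])
          (simp add: minus[OF carr[OF 3]] ring.minus_zero R cring.axioms(1) del: product_ring_simps)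
      then show ?case by (simp add: a_inv_def)
    next
      case (4 a b)
      then have "a \<oplus>\<^bsub>product_ring I R\<^esub> b \<in> direct_sum_ideal I R"
        by (intro mem[OF 4] P.a_closed[OF carr[OF 4(1)] carr[OF 4(2)]])
          (simp_all add: abelian_monoid.l_zero abelian_monoid.zero_closed abelian_group.axioms(1) ring.is_abelian_group R cring.axioms(1))
      then show ?case by simp
    qed
  next
    case (3 a x)
    note x = PiE_mem[OF 3(2)[unfolded product_ring_simps]]
    show ?case
      by (intro mem[OF 3(1) 3(1)] P.m_closed[OF 3(2) carr[OF 3(1)]]) (simp add: ring.ring_simprules x R cring.axioms(1))
  next
    case (4 a x)
    note x = PiE_mem[OF 4(2)[unfolded product_ring_simps]]
    show ?case
      by (intro mem[OF 4(1) 4(1)] P.m_closed[OF carr[OF 4(1)] 4(2)]) (simp add: ring.ring_simprules x R cring.axioms(1))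
  qed
qed

abbreviation primes :: "nat set" where
  "primes \<equiv> {p. prime p}"

abbreviation GF :: "nat \<Rightarrow> int ring" where
  "GF p \<equiv> residue_ring (int p)"

definition ring_A :: "(nat \<Rightarrow> int) set ring" where
  "ring_A = product_ring primes GF Quot direct_sum_ideal primes GF"

lemma cring_GF: "prime p \<Longrightarrow> cring (GF p)"
  by (intro residues.cring residues.intro) (use prime_gt_1_nat[of p] in simp)

lemma cring_ring_A: "cring ring_A"
  unfolding ring_A_def
  by (intro ideal.quotient_is_cring ideal_direct_sum cring_product_ring) (auto intro: cring_GF)

text \<open>The element \<open>(a\<^sub>p)\<^sub>p\<close> of \<open>\<A>\<close>; only the values of \<open>a\<close> at primes matter, and \<open>a p\<close> is meant
  to be an element of \<open>GF p\<close>.\<close>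

definition A_elem :: "(nat \<Rightarrow> int) \<Rightarrow> (nat \<Rightarrow> int) set" where
  "A_elem a = direct_sum_ideal primes GF +>\<^bsub>product_ring primes GF\<^esub> restrict a primes"

lemma A_elem_eq_iff:
  assumes "\<And>p. prime p \<Longrightarrow> a p \<in> carrier (GF p)" "\<And>p. prime p \<Longrightarrow> b p \<in> carrier (GF p)"
  shows "A_elem a = A_elem b \<longleftrightarrow> finite {p. prime p \<and> a p \<noteq> b p}"
proof -
  let ?P = "product_ring primes GF" and ?I = "direct_sum_ideal primes GF"
  interpret P: cring ?P by (rule cring_product_ring) (auto intro: cring_GF)
  interpret ideal ?I ?P by (rule ideal_direct_sum) (auto intro: cring_GF)
  have a: "restrict a primes \<in> carrier ?P" and b: "restrict b primes \<in> carrier ?P"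
    using assms by auto
  have "(\<ominus>\<^bsub>?P\<^esub> restrict b primes) = (\<lambda>p\<in>primes. (- b p) mod int p)"
  proof (rule P.minus_equality)
    show "(\<lambda>p\<in>primes. (- b p) mod int p) \<oplus>\<^bsub>?P\<^esub> restrict b primes = \<zero>\<^bsub>?P\<^esub>"
      by (auto simp: residue_ring_def mod_simps intro!: restrict_ext)
  qed (use b in \<open>auto simp: residue_ring_def prime_gt_0_nat\<close>)
  then have d: "restrict a primes \<ominus>\<^bsub>?P\<^esub> restrict b primes = (\<lambda>p\<in>primes. (a p - b p) mod int p)"
    by (auto simp: a_minus_def residue_ring_def mod_simps intro!: restrict_ext)
  have e: "(a p - b p) mod int p = 0 \<longleftrightarrow> a p = b p" if "prime p" for p
    using assms[OF that] by (auto simp: residue_ring_def mod_eq_dvd_iff[symmetric])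
  have "A_elem a = A_elem b \<longleftrightarrow> restrict a primes \<ominus>\<^bsub>?P\<^esub> restrict b primes \<in> ?I"
    unfolding A_elem_def using P.quotient_eq_iff_same_a_r_cos[OF ideal_axioms a b] by blast
  also have "\<dots> \<longleftrightarrow> finite {p. prime p \<and> a p \<noteq> b p}"
  proof -
    have "{p \<in> primes. (\<lambda>p\<in>primes. (a p - b p) mod int p) p \<noteq> \<zero>\<^bsub>GF p\<^esub>} = {p. prime p \<and> a p \<noteq> b p}"
      using e by (auto simp: residue_ring_def)
    then show ?thesis unfolding direct_sum_ideal_def mem_Collect_eq d
      using P.minus_closed[OF a b] unfolding d by simp
  qed
  finally show ?thesis .
qed

definition rat_mod :: "rat \<Rightarrow> nat \<Rightarrow> int" where
  "rat_mod x p =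
     (let (a, b) = quotient_of x in
      if int p dvd b then 0 else (a * modular_inverse (int p) b) mod int p)"


section \<open>The sums \<open>\<omega>\<close>\<close>

definition compositions :: "nat \<Rightarrow> nat \<Rightarrow> nat list set" where
  "compositions n r = {ms. length ms = r \<and> sum_list ms = n \<and> (\<forall>m\<in>set ms. 0 < m)}"

definition omega :: "nat \<Rightarrow> nat list \<Rightarrow> rat" where
  "omega n ks =
     (\<Sum>ms\<in>compositions n (length ks). \<Prod>a<length ks. 1 / of_nat (ms ! a) ^ (ks ! a))"

definition omega_A :: "nat list \<Rightarrow> (nat \<Rightarrow> int) set" where
  "omega_A ks = A_elem (\<lambda>p. rat_mod (omega p ks) p)"

definition q_int :: "'a::field \<Rightarrow> nat \<Rightarrow> 'a" where
  "q_int q m = (\<Sum>i<m. q ^ i)"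

text \<open>The value of the rational function at the point \<open>q\<close>, meaningful whenever no \<open>q_int q m\<close>
  with \<open>m\<close> a part of one of the compositions vanishes.\<close>

definition omega_q :: "nat \<Rightarrow> nat list \<Rightarrow> 'a::field \<Rightarrow> 'a" where
  "omega_q n ks q =
     (\<Sum>ms\<in>compositions n (length ks). \<Prod>a<length ks.
        q ^ ((ks ! a - 1) * (ms ! a)) / q_int q (ms ! a) ^ (ks ! a))"


section \<open>\<open>\<int>[\<zeta>]\<close> and its residue ring modulo \<open>1 - \<zeta>\<close>\<close>

definition primitive_root_of_unity :: "nat \<Rightarrow> complex \<Rightarrow> bool" where
  "primitive_root_of_unity n z \<longleftrightarrow>
     0 < n \<and> z ^ n = 1 \<and> (\<forall>m. 0 < m \<and> m < n \<longrightarrow> z ^ m \<noteq> 1)"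

definition Z_adjoin :: "complex \<Rightarrow> complex ring" where
  "Z_adjoin z = ring_of_type_algebra\<lparr>carrier := generate_ring ring_of_type_algebra {z}\<rparr>"

lemma cring_Z_adjoin: "cring (Z_adjoin z)"
proof -
  interpret C: cring "ring_of_type_algebra :: complex ring" by (rule cring_from_type_algebra)
  show ?thesis unfolding Z_adjoin_def
    by (intro C.subcring_iff[THEN iffD1] C.subcringI' C.generate_ring_is_subring) (auto simp: ring_of_type_algebra_def generate_ring.intros)
qed

definition one_minus_ideal :: "complex \<Rightarrow> complex set" where
  "one_minus_ideal z = PIdl\<^bsub>Z_adjoin z\<^esub> (1 - z)"

definition residue_class :: "complex \<Rightarrow> complex \<Rightarrow> complex set" where
  "residue_class z x = one_minus_ideal z +>\<^bsub>Z_adjoin z\<^esub> x"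

text \<open>For \<open>z\<close> a primitive \<open>p\<close>-th root of unity, the unique ring isomorphism from
  \<open>Z_adjoin z Quot one_minus_ideal z\<close> to \<open>GF p\<close>, given as the inverse of the map that sends the
  representative \<open>c \<in> {0..p - 1}\<close> to the class of the integer \<open>c\<close>.\<close>

definition to_GF :: "nat \<Rightarrow> complex \<Rightarrow> complex set \<Rightarrow> int" where
  "to_GF p z = inv_into (carrier (GF p)) (\<lambda>c. residue_class z (of_int c))"

end

theory Submission
  imports Defs
begin

text \<open>
  If \<open>m n \<equiv> 1\<close> modulo \<open>p\<close>, then \<open>1 / [m] = (1 - \<zeta>\<^bsup>m n\<^esup>) / (1 - \<zeta>\<^bsup>m\<^esup>)\<close> is the sum of
  \<open>\<zeta>\<^bsup>m i\<^esup>\<close> over \<open>i < n\<close>, which lies in \<open>\<int>[\<zeta>]\<close> and is congruent to \<open>n\<close> modulo \<open>1 - \<zeta>\<close>; and \<open>1 / m\<close>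
  reduces to \<open>n\<close> modulo \<open>p\<close> as well. Both sides of the theorem therefore reduce to the same integer.
  That the residue ring is not smaller than \<open>\<int>/p\<close> is seen as follows: if \<open>1\<close> were a multiple of
  \<open>1 - \<zeta>\<close>, then, since \<open>p\<close> divides \<open>(1 - \<zeta>)\<^sup>p\<close>, it would be a multiple of \<open>p\<close> in \<open>\<int>[\<zeta>]\<close>; this
  contradicts Nakayama's lemma for the finitely generated \<open>\<int>\<close>-module \<open>\<int>[\<zeta>]\<close>.
\<close>

section \<open>Reduction to integers\<close>

text \<open>Read \<open>red x a\<close> as: \<open>x\<close> has the integer \<open>a\<close> as
  residue. A relation fits because \<open>x\<close> may range over a proper subring only and
  \<open>a\<close> is determined only up to a multiple of \<open>p\<close>. Both sides of the
  theorem are instances, so sums, products and powers are treated once.\<close>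

locale int_reduction =
  fixes red :: "'a::comm_ring_1 \<Rightarrow> int \<Rightarrow> bool"
  assumes red_zero: "red 0 0"
    and red_one: "red 1 1"
    and red_add: "red x a \<Longrightarrow> red y b \<Longrightarrow> red (x + y) (a + b)"
    and red_mult: "red x a \<Longrightarrow> red y b \<Longrightarrow> red (x * y) (a * b)"
begin

lemma red_sum: "(\<And>i. i \<in> I \<Longrightarrow> red (f i) (g i)) \<Longrightarrow> red (sum f I) (sum g I)"
  by (induction I rule: infinite_finite_induct) (auto intro: red_zero red_add)

lemma red_prod: "(\<And>i. i \<in> I \<Longrightarrow> red (f i) (g i)) \<Longrightarrow> red (prod f I) (prod g I)"
  by (induction I rule: infinite_finite_induct) (auto intro: red_one red_mult)

lemma red_power: "red x a \<Longrightarrow> red (x ^ k) (a ^ k)"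
  by (induction k) (auto intro: red_one red_mult)

end

text \<open>The common integer to which both sides are reduced.\<close>

definition omega_residue :: "nat \<Rightarrow> nat list \<Rightarrow> int" where
  "omega_residue p ks =
     (\<Sum>ms\<in>compositions p (length ks). \<Prod>a<length ks.
        modular_inverse (int p) (int (ms ! a)) ^ (ks ! a))"

text \<open>Here depth at least 2 enters: a second positive part keeps every part below
  \<open>n\<close>, hence invertible modulo \<open>n\<close> when \<open>n\<close> is prime.\<close>

lemma compositions_nth_bounds:
  assumes "ms \<in> compositions n r" "r \<ge> 2" "a < r"
  shows "0 < ms ! a" "ms ! a < n"
proof -
  have len: "length ms = r" and s: "sum_list ms = n" and pos: "\<And>i. i < r \<Longrightarrow> 0 < ms ! i"
    using assms(1) by (auto simp: compositions_def)
  show "0 < ms ! a" using pos assms(3) .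
  define b where "b = (if a = 0 then 1 else 0 :: nat)"
  have b: "b < r" "b \<noteq> a" using assms(2) by (auto simp: b_def)
  have "ms ! a + ms ! b = (\<Sum>i\<in>{a, b}. ms ! i)" using b by simp
  also have "\<dots> \<le> (\<Sum>i<r. ms ! i)" using b assms(3) by (intro sum_mono2) auto
  also have "\<dots> = n" using len s by (simp add: sum_list_sum_nth atLeast0LessThan)
  finally show "ms ! a < n" using pos[OF b(1)] by simp
qed

lemma cong_modular_inverse_prime:
  assumes "prime p" "0 < m" "m < p"
  shows "[int m * modular_inverse (int p) (int m) = 1] (mod int p)"
proof -
  have "coprime p m"
    using assms by (meson prime_imp_coprime nat_dvd_not_less)
  then have "coprime (int m) (int p)" by (simp add: coprime_commute)
  then show ?thesis by (rule cong_modular_inverse1)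
qed

section \<open>Reduction of rationals modulo \<open>p\<close>\<close>

text \<open>The fraction need not be in lowest terms, so sums and products need no cancellation, and
  the residue is expressed without modular division.\<close>

definition rat_red :: "nat \<Rightarrow> rat \<Rightarrow> int \<Rightarrow> bool" where
  "rat_red p x c \<longleftrightarrow> (\<exists>a b. \<not> int p dvd b \<and> x * of_int b = of_int a \<and> [a = c * b] (mod int p))"

lemma int_reduction_rat_red:
  assumes "prime p"
  shows "int_reduction (rat_red p)"
proof
  have p: "prime (int p)" using assms by simp
  then have p1: "\<not> int p dvd 1" using not_prime_unit by blast
  show "rat_red p 0 0"
    unfolding rat_red_def using p1 by (intro exI[of _ 0] exI[of _ 1]) simp
  show "rat_red p 1 1"
    unfolding rat_red_def using p1 by (intro exI[of _ 1]) simp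
  fix x y c d
  assume "rat_red p x c" "rat_red p y d"
  then obtain a b a' b' where
    h: "\<not> int p dvd b" "x * of_int b = of_int a" "[a = c * b] (mod int p)"
       "\<not> int p dvd b'" "y * of_int b' = of_int a'" "[a' = d * b'] (mod int p)"
    unfolding rat_red_def by blast
  have nd: "\<not> int p dvd b * b'" using h(1,4) p by (simp add: prime_dvd_mult_iff)
  have "(x + y) * of_int (b * b') = x * of_int b * of_int b' + y * of_int b' * of_int b"
    by (simp add: algebra_simps)
  then have eq: "(x + y) * of_int (b * b') = of_int (a * b' + a' * b)"
    using h(2,5) by simp
  have "[a * b' + a' * b = c * b * b' + d * b' * b] (mod int p)"
    using h(3,6) by (intro cong_add cong_mult) auto
  then have "[a * b' + a' * b = (c + d) * (b * b')] (mod int p)"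
    by (simp add: algebra_simps)
  with nd eq show "rat_red p (x + y) (c + d)" unfolding rat_red_def by blast
  have "(x * y) * of_int (b * b') = (x * of_int b) * (y * of_int b')"
    by (simp add: algebra_simps)
  then have eq: "(x * y) * of_int (b * b') = of_int (a * a')"
    using h(2,5) by simp
  have "[a * a' = (c * b) * (d * b')] (mod int p)"
    using h(3,6) by (rule cong_mult)
  then have "[a * a' = (c * d) * (b * b')] (mod int p)"
    by (simp add: algebra_simps)
  with nd eq show "rat_red p (x * y) (c * d)" unfolding rat_red_def by blast
qed

text \<open>Cross-multiplying the given fraction with the reduced one transfers both the denominator
  condition and the residue to the reduced one.\<close>

lemma rat_mod_eq:
  assumes "prime p" "rat_red p x c"
  shows "rat_mod x p = c mod int p"
proof -
  have p: "prime (int p)" using assms(1) by simp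
  obtain a b where q: "quotient_of x = (a, b)" by force
  obtain a' b' where h: "\<not> int p dvd b'" "x * of_int b' = of_int a'" "[a' = c * b'] (mod int p)"
    using assms(2) unfolding rat_red_def by blast
  have b: "b > 0" and cop: "coprime a b" and x: "x = of_int a / of_int b"
    using quotient_of_denom_pos[OF q] quotient_of_coprime[OF q] quotient_of_div[OF q] by auto
  have "of_int (a * b') = (of_int (a' * b) :: rat)"
    using h(2) b x by (simp add: field_simps)
  then have e: "a * b' = a' * b" unfolding of_int_eq_iff .
  \<comment> \<open>This rules out the default value 0 of \<open>rat_mod\<close>.\<close>
  have pb: "\<not> int p dvd b"
  proof
    assume d: "int p dvd b"
    then have "int p dvd a * b'" using e by simp
    then have "int p dvd a" using h(1) p by (simp add: prime_dvd_mult_iff)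
    with d cop have "is_unit (int p)" by (meson coprime_def)
    with p show False using not_prime_unit by blast
  qed
  have cb: "coprime b (int p)" and cb': "coprime b' (int p)"
    using prime_imp_coprime[OF p pb] prime_imp_coprime[OF p h(1)] by (simp_all add: coprime_commute)
  have "[a * b' = c * b' * b] (mod int p)"
    unfolding e using h(3) by (intro cong_mult) auto
  then have "[a * b' = (c * b) * b'] (mod int p)" by (simp add: mult_ac)
  then have "[a = c * b] (mod int p)" using cb' by (simp add: cong_mult_rcancel)
  then have "[a * modular_inverse (int p) b = c * b * modular_inverse (int p) b] (mod int p)"
    by (intro cong_mult) auto
  also have "c * b * modular_inverse (int p) b = c * (b * modular_inverse (int p) b)"
    by simp
  also have "[\<dots> = c * 1] (mod int p)"
    using cb by (intro cong_mult cong_modular_inverse1 cong_refl)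
  finally show ?thesis using pb q by (simp add: rat_mod_def cong_def)
qed

lemma rat_mod_omega:
  assumes "prime p" "length ks \<ge> 2"
  shows "rat_mod (omega p ks) p = omega_residue p ks mod int p"
proof (rule rat_mod_eq[OF assms(1)])
  interpret int_reduction "rat_red p" by (rule int_reduction_rat_red[OF assms(1)])
  have "rat_red p (1 / of_nat m) (modular_inverse (int p) (int m))" if "0 < m" "m < p" for m
    unfolding rat_red_def using that cong_modular_inverse_prime[OF assms(1) that]
    by (intro exI[of _ "1::int"] exI[of _ "int m"]) (auto simp: mult.commute cong_sym dest: zdvd_imp_le)
  then have "rat_red p (1 / of_nat m ^ k) (modular_inverse (int p) (int m) ^ k)"
    if "0 < m" "m < p" for m k
    using red_power[of "1 / of_nat m" _ k] that by (simp add: power_one_over)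
  then show "rat_red p (omega p ks) (omega_residue p ks)"
    unfolding omega_def omega_residue_def
    by (intro red_sum red_prod) (use compositions_nth_bounds assms(2) in force)
qed

section \<open>The ring \<open>\<int>[z]\<close>\<close>

lemma a_inv_ring_of_type_algebra:
  "\<ominus>\<^bsub>ring_of_type_algebra\<^esub> x = - (x :: 'a::comm_ring_1)"
proof -
  interpret cring "ring_of_type_algebra :: 'a ring" by (rule cring_from_type_algebra)
  show ?thesis by (rule minus_equality) (auto simp: ring_of_type_algebra_def)
qed

lemma Z_adjoin_simps:
  "x \<otimes>\<^bsub>Z_adjoin z\<^esub> y = x * y"
  "x \<oplus>\<^bsub>Z_adjoin z\<^esub> y = x + y"
  "\<zero>\<^bsub>Z_adjoin z\<^esub> = 0"
  "\<one>\<^bsub>Z_adjoin z\<^esub> = 1"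
  by (simp_all add: Z_adjoin_def ring_of_type_algebra_def)

lemma Z_adjoin_induct [consumes 1, case_names one gen uminus add mult]:
  assumes "x \<in> carrier (Z_adjoin z)" "P 1" "P z"
    and "\<And>x. P x \<Longrightarrow> P (- x)"
    and "\<And>x y. P x \<Longrightarrow> P y \<Longrightarrow> P (x + y)" "\<And>x y. P x \<Longrightarrow> P y \<Longrightarrow> P (x * y)"
  shows "P x"
proof -
  have "x \<in> generate_ring ring_of_type_algebra {z}" using assms(1) by (simp add: Z_adjoin_def)
  then show ?thesis
    by induction (use assms(2-) in
      \<open>simp_all add: a_inv_ring_of_type_algebra, simp_all add: ring_of_type_algebra_def\<close>)
qed

lemma Z_adjoin_one: "1 \<in> carrier (Z_adjoin z)"
  and Z_adjoin_zero: "0 \<in> carrier (Z_adjoin z)"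
  and Z_adjoin_add: "x \<in> carrier (Z_adjoin z) \<Longrightarrow> y \<in> carrier (Z_adjoin z) \<Longrightarrow> x + y \<in> carrier (Z_adjoin z)"
  and Z_adjoin_mult: "x \<in> carrier (Z_adjoin z) \<Longrightarrow> y \<in> carrier (Z_adjoin z) \<Longrightarrow> x * y \<in> carrier (Z_adjoin z)"
proof -
  interpret cring "Z_adjoin z" by (rule cring_Z_adjoin)
  show "1 \<in> carrier (Z_adjoin z)" "0 \<in> carrier (Z_adjoin z)"
    "x \<in> carrier (Z_adjoin z) \<Longrightarrow> y \<in> carrier (Z_adjoin z) \<Longrightarrow> x + y \<in> carrier (Z_adjoin z)"
    "x \<in> carrier (Z_adjoin z) \<Longrightarrow> y \<in> carrier (Z_adjoin z) \<Longrightarrow> x * y \<in> carrier (Z_adjoin z)"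
    using one_closed zero_closed a_closed m_closed by (simp_all add: Z_adjoin_simps)
qed

lemma Z_adjoin_gen: "z \<in> carrier (Z_adjoin z)"
  by (auto simp: Z_adjoin_def intro: generate_ring.incl)

lemma Z_adjoin_uminus:
  assumes "x \<in> carrier (Z_adjoin z)" shows "- x \<in> carrier (Z_adjoin z)"
  using assms generate_ring.a_inv[of x ring_of_type_algebra "{z}"]
  by (simp add: Z_adjoin_def a_inv_ring_of_type_algebra)

lemma Z_adjoin_diff:
  "x \<in> carrier (Z_adjoin z) \<Longrightarrow> y \<in> carrier (Z_adjoin z) \<Longrightarrow> x - y \<in> carrier (Z_adjoin z)"
  using Z_adjoin_add[of x z "- y"] Z_adjoin_uminus by simp

lemma Z_adjoin_power: "x \<in> carrier (Z_adjoin z) \<Longrightarrow> x ^ k \<in> carrier (Z_adjoin z)"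
  by (induction k) (auto intro: Z_adjoin_one Z_adjoin_mult)

lemma Z_adjoin_sum:
  "(\<And>i. i \<in> I \<Longrightarrow> f i \<in> carrier (Z_adjoin z)) \<Longrightarrow> sum f I \<in> carrier (Z_adjoin z)"
  by (induction I rule: infinite_finite_induct) (auto intro: Z_adjoin_zero Z_adjoin_add)

lemma Z_adjoin_of_nat: "of_nat n \<in> carrier (Z_adjoin z)"
  by (induction n) (auto intro: Z_adjoin_zero Z_adjoin_one Z_adjoin_add)

lemma Z_adjoin_of_int: "of_int c \<in> carrier (Z_adjoin z)"
  by (cases c rule: int_cases2) (auto intro: Z_adjoin_of_nat Z_adjoin_uminus)

lemmas Z_adjoin_intros = Z_adjoin_one Z_adjoin_zero Z_adjoin_add Z_adjoin_mult Z_adjoin_gen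
  Z_adjoin_uminus Z_adjoin_diff Z_adjoin_power Z_adjoin_sum Z_adjoin_of_nat Z_adjoin_of_int

text \<open>Replaces cosets by explicit multiples of \<open>1 - z\<close>, so that the later
  computations take place in the complex numbers.\<close>

lemma residue_class_eq_iff:
  assumes "x \<in> carrier (Z_adjoin z)" "y \<in> carrier (Z_adjoin z)"
  shows "residue_class z x = residue_class z y \<longleftrightarrow>
    (\<exists>s\<in>carrier (Z_adjoin z). x = y + (1 - z) * s)"
proof -
  interpret cring "Z_adjoin z" by (rule cring_Z_adjoin)
  have "1 - z \<in> carrier (Z_adjoin z)" by (intro Z_adjoin_intros)
  then have I: "ideal (one_minus_ideal z) (Z_adjoin z)"
    unfolding one_minus_ideal_def by (rule cgenideal_ideal)
  have "\<ominus>\<^bsub>Z_adjoin z\<^esub> y = - y"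
    using assms(2) by (intro minus_equality) (auto simp: Z_adjoin_simps intro: Z_adjoin_uminus)
  then have "x \<ominus>\<^bsub>Z_adjoin z\<^esub> y = x - y" by (simp add: a_minus_def Z_adjoin_simps)
  then have "residue_class z x = residue_class z y \<longleftrightarrow> x - y \<in> one_minus_ideal z"
    using quotient_eq_iff_same_a_r_cos[OF I assms] by (simp add: residue_class_def)
  also have "\<dots> \<longleftrightarrow> (\<exists>s\<in>carrier (Z_adjoin z). x = y + (1 - z) * s)"
    unfolding one_minus_ideal_def cgenideal_def by (auto simp: Z_adjoin_simps algebra_simps)
  finally show ?thesis .
qed

section \<open>Reduction modulo \<open>1 - z\<close>\<close>

text \<open>The relation entails that \<open>x\<close> lies in \<open>Z_adjoin z\<close>, so one
  derivation yields both integrality and the residue.\<close>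

definition zeta_red :: "complex \<Rightarrow> complex \<Rightarrow> int \<Rightarrow> bool" where
  "zeta_red z x c \<longleftrightarrow> (\<exists>s\<in>carrier (Z_adjoin z). x = of_int c + (1 - z) * s)"

lemma zeta_red_imp_Z_adjoin: "zeta_red z x c \<Longrightarrow> x \<in> carrier (Z_adjoin z)"
  unfolding zeta_red_def by (auto intro!: Z_adjoin_intros)

lemma residue_class_eq_of_int_iff:
  assumes "x \<in> carrier (Z_adjoin z)"
  shows "residue_class z x = residue_class z (of_int c) \<longleftrightarrow> zeta_red z x c"
  unfolding zeta_red_def by (rule residue_class_eq_iff[OF assms Z_adjoin_of_int])

lemma zeta_red_of_int: "zeta_red z (of_int c) c"
  unfolding zeta_red_def by (rule bexI[OF _ Z_adjoin_zero]) simp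

lemma zeta_red_gen: "zeta_red z z 1"
  unfolding zeta_red_def by (rule bexI[of _ "- 1"]) (auto intro: Z_adjoin_intros)

lemma int_reduction_zeta_red: "int_reduction (zeta_red z)"
proof
  show "zeta_red z 0 0" "zeta_red z 1 1"
    using zeta_red_of_int[of z 0] zeta_red_of_int[of z 1] by simp_all
  fix x y c d
  assume "zeta_red z x c" "zeta_red z y d"
  then obtain s t where s: "s \<in> carrier (Z_adjoin z)" "x = of_int c + (1 - z) * s"
    and t: "t \<in> carrier (Z_adjoin z)" "y = of_int d + (1 - z) * t"
    unfolding zeta_red_def by blast
  show "zeta_red z (x + y) (c + d)"
    unfolding zeta_red_def
    by (rule bexI[of _ "s + t"])
      (simp add: s(2) t(2) algebra_simps, intro Z_adjoin_intros s t)
  show "zeta_red z (x * y) (c * d)"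
    unfolding zeta_red_def
    by (rule bexI[of _ "of_int c * t + of_int d * s + (1 - z) * s * t"])
      (simp add: s(2) t(2) algebra_simps, intro Z_adjoin_intros s t)
qed

lemma zeta_red_minus_int:
  assumes "zeta_red z x c" "zeta_red z x d"
  shows "zeta_red z 0 (c - d)"
proof -
  obtain s t where "s \<in> carrier (Z_adjoin z)" "x = of_int c + (1 - z) * s"
    "t \<in> carrier (Z_adjoin z)" "x = of_int d + (1 - z) * t"
    using assms unfolding zeta_red_def by blast
  then show ?thesis unfolding zeta_red_def
    by (intro bexI[of _ "s - t"]) (auto simp: algebra_simps intro: Z_adjoin_intros)
qed

text \<open>Nakayama's lemma for \<open>\<int>\<close>-modules, in a form that eliminates one generator at a time.\<close>

lemma nakayama_int:
  fixes e :: "'b \<Rightarrow> 'a::{idom, ring_char_0}" and p :: int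
  assumes "finite I" "prime p"
    and "\<And>i. i \<in> I \<Longrightarrow> \<not> p dvd n i"
    and "\<And>i. i \<in> I \<Longrightarrow> of_int (n i) * e i = of_int p * (\<Sum>j\<in>I. of_int (a i j) * e j)"
  shows "\<forall>i\<in>I. e i = 0"
  using assms(1,3,4)
proof (induction I arbitrary: n a rule: finite_induct)
  case empty
  then show ?case by simp
next
  case (insert k I)
  \<comment> \<open>Moving the diagonal term of the relation for \<open>e k\<close> to the left
    leaves the coefficient \<open>c\<close>, congruent to \<open>n k\<close> modulo
    \<open>p\<close>.\<close>
  define c where "c = n k - p * a k k"
  have c: "\<not> p dvd c" using insert.prems(1)[of k] by (auto simp: c_def dvd_diff_left_iff)
  have "of_int (n k) * e k = of_int p * (of_int (a k k) * e k + (\<Sum>j\<in>I. of_int (a k j) * e j))"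
    using insert.prems(2)[of k] insert.hyps by simp
  then have ck: "of_int c * e k = of_int p * (\<Sum>j\<in>I. of_int (a k j) * e j)"
    by (simp add: c_def algebra_simps)
  \<comment> \<open>Multiply the relation for \<open>e i\<close> by \<open>c\<close> and substitute
    that for \<open>e k\<close>. The left coefficient becomes \<open>c * n i\<close>, still prime to
    \<open>p\<close>; this is why the left coefficients are not fixed to be 1.\<close>
  have "\<forall>i\<in>I. e i = 0"
  proof (rule insert.IH)
    fix i assume i: "i \<in> I"
    show "\<not> p dvd c * n i"
      using c insert.prems(1)[of i] i \<open>prime p\<close> by (simp add: prime_dvd_mult_iff)
    have "of_int (n i) * e i = of_int p * (of_int (a i k) * e k + (\<Sum>j\<in>I. of_int (a i j) * e j))"
      using insert.prems(2)[of i] insert.hyps i by simp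
    then have "of_int (c * n i) * e i = of_int p *
        (of_int (a i k) * (of_int c * e k) + of_int c * (\<Sum>j\<in>I. of_int (a i j) * e j))"
      by (simp add: algebra_simps)
    also have "\<dots> = of_int p * (\<Sum>j\<in>I. of_int (c * a i j + p * a i k * a k j) * e j)"
      unfolding ck by (simp add: sum_distrib_left sum.distrib algebra_simps)
    finally show "of_int (c * n i) * e i =
        of_int p * (\<Sum>j\<in>I. of_int (c * a i j + p * a i k * a k j) * e j)" .
  qed
  \<comment> \<open>The relation for \<open>e k\<close> has become \<open>c * e k = 0\<close>, and
    \<open>c\<close> is nonzero since \<open>p\<close> does not divide it.\<close>
  moreover from this have "of_int c * e k = 0" using ck by simp
  then have "e k = 0" using c by auto
  ultimately show ?case by simp
qed

section \<open>Finite generation of \<open>Z_adjoin z\<close> and properness of the ideal of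
  \<open>1 - z\<close>\<close>

lemma Z_adjoin_span:
  assumes "x \<in> carrier (Z_adjoin z)" "z ^ n = 1" "0 < n"
  shows "\<exists>a. x = (\<Sum>i<n. of_int (a i) * z ^ i)"
proof -
  define T where "T = {\<Sum>i<n. of_int (a i) * z ^ i | a. True}"
  have TI: "u \<in> T" if "u = (\<Sum>i<n. of_int (a i) * z ^ i)" for u and a :: "nat \<Rightarrow> int"
    using that unfolding T_def by auto
  have uminus: "- u \<in> T" if u: "u \<in> T" for u
  proof -
    obtain a where "u = (\<Sum>i<n. of_int (a i) * z ^ i)" using u unfolding T_def by blast
    then have "- u = (\<Sum>i<n. of_int (- a i) * z ^ i)" by (simp add: sum_negf)
    then show ?thesis by (rule TI)
  qed
  have add: "u + v \<in> T" if uv: "u \<in> T" "v \<in> T" for u v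
  proof -
    obtain a b where "u = (\<Sum>i<n. of_int (a i) * z ^ i)" "v = (\<Sum>i<n. of_int (b i) * z ^ i)"
      using uv unfolding T_def by blast
    then have "u + v = (\<Sum>i<n. of_int (a i + b i) * z ^ i)"
      by (simp add: sum.distrib algebra_simps)
    then show ?thesis by (rule TI)
  qed
  have zmult: "z * u \<in> T" if u: "u \<in> T" for u
  proof -
    obtain a where a: "u = (\<Sum>i<n. of_int (a i) * z ^ i)" using u unfolding T_def by blast
    obtain m where m: "n = Suc m" using assms(3) gr0_conv_Suc by blast
    \<comment> \<open>Multiplication by \<open>z\<close> shifts the coefficients cyclically: the
      last one returns to the constant term because \<open>z ^ n = 1\<close>.\<close>
    define b where "b i = (case i of 0 \<Rightarrow> a m | Suc j \<Rightarrow> a j)" for i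
    have "z * u = (\<Sum>i<m. of_int (a i) * z ^ Suc i) + of_int (a m) * z ^ n"
      unfolding a m by (simp add: sum_distrib_left algebra_simps)
    also have "\<dots> = (\<Sum>i<n. of_int (b i) * z ^ i)"
      unfolding assms(2) unfolding m sum.lessThan_Suc_shift by (simp add: b_def)
    finally show ?thesis by (rule TI)
  qed
  \<comment> \<open>Inducting on \<open>x\<close> mapping \<open>T\<close> into itself makes the
    product case a composition; applying the result to 1 then gives \<open>x\<close> itself.\<close>
  have "\<forall>u\<in>T. x * u \<in> T"
    using assms(1)
    by (induction rule: Z_adjoin_induct) (auto simp: uminus add zmult distrib_right mult.assoc)
  moreover have "1 \<in> T"
    using assms(3) by (intro TI[of _ "\<lambda>i. if i = 0 then 1 else 0"])
      (simp add: if_distrib[of of_int] if_distrib[of "\<lambda>x. x * _"] cong: if_cong)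
  ultimately have "x * 1 \<in> T" by blast
  then show ?thesis unfolding T_def by auto
qed

text \<open>In the binomial expansion the inner coefficients are divisible by \<open>p\<close>; the
  two outer terms add up to 0 for odd \<open>p\<close> and to 2 for \<open>p = 2\<close>.\<close>

lemma one_minus_root_power_prime:
  assumes "prime p" "z ^ p = 1"
  shows "\<exists>s\<in>carrier (Z_adjoin z). (1 - z) ^ p = of_nat p * s"
proof -
  have p: "p \<ge> 2" using assms(1) prime_ge_2_nat by blast
  have mid: "\<exists>s\<in>carrier (Z_adjoin z). of_nat (p choose k) * (- z) ^ k = of_nat p * s"
    if "k \<in> {0<..<p}" for k
  proof -
    have "p dvd (p choose k)" using that assms(1) by (intro dvd_choose_prime) auto
    then obtain q where q: "p choose k = p * q" by blast
    show ?thesis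
      by (rule bexI[of _ "of_nat q * (- z) ^ k"]) (auto simp: q intro!: Z_adjoin_intros)
  qed
  then obtain f where f: "\<And>k. k \<in> {0<..<p} \<Longrightarrow> f k \<in> carrier (Z_adjoin z)"
    "\<And>k. k \<in> {0<..<p} \<Longrightarrow> of_nat (p choose k) * (- z) ^ k = of_nat p * f k"
    by metis
  have ends: "\<exists>t\<in>carrier (Z_adjoin z). 1 + (- z) ^ p = of_nat p * t"
  proof (cases "p = 2")
    case True
    then show ?thesis using assms(2) by (intro bexI[of _ 1]) (auto intro: Z_adjoin_intros)
  next
    case False
    then have "odd p" using assms(1) p prime_odd_nat by force
    then show ?thesis using assms(2) by (intro bexI[of _ 0]) (auto intro: Z_adjoin_intros)
  qed
  then obtain t where t: "t \<in> carrier (Z_adjoin z)" "1 + (- z) ^ p = of_nat p * t" by blast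
  have "(1 - z) ^ p = ((- z) + 1) ^ p" by simp
  also have "\<dots> = (\<Sum>k\<le>p. of_nat (p choose k) * (- z) ^ k)"
    unfolding binomial_ring by simp
  also have "{..p} = insert 0 (insert p {0<..<p})" using p by auto
  also have "(\<Sum>k\<in>\<dots>. of_nat (p choose k) * (- z) ^ k)
      = (1 + (- z) ^ p) + (\<Sum>k\<in>{0<..<p}. of_nat (p choose k) * (- z) ^ k)"
    using p by simp
  also have "(\<Sum>k\<in>{0<..<p}. of_nat (p choose k) * (- z) ^ k) = (\<Sum>k\<in>{0<..<p}. of_nat p * f k)"
    by (intro sum.cong f(2) refl)
  also have "1 + (- z) ^ p + \<dots> = of_nat p * (t + (\<Sum>k\<in>{0<..<p}. f k))"
    unfolding t(2) by (simp add: sum_distrib_left algebra_simps)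
  finally show ?thesis
    by (intro bexI[of _ "t + (\<Sum>k\<in>{0<..<p}. f k)"]) (auto intro!: Z_adjoin_intros t f)
qed

lemma not_zeta_red_0_1:
  assumes "prime p" "z ^ p = 1"
  shows "\<not> zeta_red z 0 1"
proof
  assume "zeta_red z 0 1"
  \<comment> \<open>The assumption makes \<open>1 - z\<close> a unit with inverse
    \<open>- s\<close>.\<close>
  then obtain s where s: "s \<in> carrier (Z_adjoin z)" "1 = (1 - z) * (- s)"
    unfolding zeta_red_def by (auto simp: algebra_simps)
  obtain u where u: "u \<in> carrier (Z_adjoin z)" "(1 - z) ^ p = of_nat p * u"
    using one_minus_root_power_prime[OF assms] by blast
  \<comment> \<open>Taking \<open>p\<close>-th powers of \<open>1 = (1 - z) * (- s)\<close> turns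
    this into an inverse \<open>t\<close> of \<open>p\<close>.\<close>
  define t where "t = u * (- s) ^ p"
  have t: "t \<in> carrier (Z_adjoin z)" unfolding t_def by (intro Z_adjoin_intros s u)
  have "1 = ((1 - z) * (- s)) ^ p" using s(2) by simp
  also have "\<dots> = of_nat p * t" unfolding power_mult_distrib u(2) t_def by simp
  finally have pt: "1 = of_nat p * t" .
  have p0: "0 < p" using assms(1) prime_gt_0_nat by blast
  have "\<exists>a. t * z ^ i = (\<Sum>j<p. of_int (a j) * z ^ j)" for i
    by (rule Z_adjoin_span) (use assms p0 in \<open>auto intro!: Z_adjoin_intros t\<close>)
  then obtain a where a: "\<And>i. t * z ^ i = (\<Sum>j<p. of_int (a i j) * z ^ j)" by metis
  \<comment> \<open>Since \<open>z ^ i = p * (t * z ^ i)\<close>, expanding \<open>t * z ^ i\<close>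
    in the powers of \<open>z\<close> gives the system for Nakayama with left coefficients
    1.\<close>
  have "\<forall>i\<in>{..<p}. z ^ i = 0"
  proof (rule nakayama_int)
    show "prime (int p)" using assms(1) by simp
    show "\<not> int p dvd (\<lambda>_. 1) i" for i :: nat using assms(1) by (auto simp: not_prime_unit)
    show "of_int ((\<lambda>_. 1) i) * z ^ i = of_int (int p) * (\<Sum>j<p. of_int (a i j) * z ^ j)" for i
      unfolding a[symmetric] using pt by (simp add: mult.assoc[symmetric])
  qed simp
  then have "z ^ 0 = 0" using p0 by blast
  then show False by simp
qed

section \<open>The residue ring as the field with \<open>p\<close> elements\<close>

text \<open>The vanishing sum of all powers of \<open>z\<close> has residue \<open>p\<close>, so
  multiples of \<open>p\<close> reduce to 0. Any other integer reducing to 0 would, by Bezout, make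
  1 do so as well.\<close>

lemma zeta_red_0_iff:
  assumes "prime p" "primitive_root_of_unity p z"
  shows "zeta_red z 0 c \<longleftrightarrow> int p dvd c"
proof -
  interpret int_reduction "zeta_red z" by (rule int_reduction_zeta_red)
  have zp: "z ^ p = 1" and z1: "z \<noteq> 1"
    using assms prime_gt_1_nat[of p] unfolding primitive_root_of_unity_def
    by (auto dest: spec[of _ 1])
  have "(\<Sum>i<p. z ^ i) = 0" using zp z1 by (simp add: sum_gp_strict)
  moreover have "zeta_red z (\<Sum>i<p. z ^ i) (\<Sum>i<p. 1 ^ i)"
    by (intro red_sum red_power zeta_red_gen)
  ultimately have p: "zeta_red z 0 (int p)" by simp
  show ?thesis
  proof
    assume "int p dvd c"
    then obtain k where "c = int p * k" by blast
    then show "zeta_red z 0 c" using red_mult[OF p zeta_red_of_int[of z k]] by simp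
  next
    assume c: "zeta_red z 0 c"
    show "int p dvd c"
    proof (rule ccontr)
      assume "\<not> int p dvd c"
      then have "coprime (int p) c" using assms(1) by (intro prime_imp_coprime) auto
      then obtain u v where "u * int p + v * c = 1"
        using bezout_int[of "int p" c] by auto
      then have "zeta_red z (of_int u * 0 + of_int v * 0) 1"
        using red_add[OF red_mult[OF zeta_red_of_int p] red_mult[OF zeta_red_of_int c]] by metis
      then show False using not_zeta_red_0_1[OF assms(1) zp] by simp
    qed
  qed
qed

lemma to_GF_residue_class:
  assumes "prime p" "primitive_root_of_unity p z" "zeta_red z x c"
  shows "to_GF p z (residue_class z x) = c mod int p"
proof -
  interpret int_reduction "zeta_red z" by (rule int_reduction_zeta_red)
  have p0: "0 < p" using assms(1) prime_gt_0_nat by blast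
  have carr: "carrier (GF p) = {0..int p - 1}" by (simp add: residue_ring_def)
  \<comment> \<open>Injectivity makes \<open>inv_into\<close> return the intended
    representative.\<close>
  have inj: "inj_on (\<lambda>c. residue_class z (of_int c)) (carrier (GF p))"
  proof (rule inj_onI)
    fix a b assume ab: "a \<in> carrier (GF p)" "b \<in> carrier (GF p)"
      "residue_class z (of_int a) = residue_class z (of_int b)"
    then have "zeta_red z (of_int a) b" by (simp add: residue_class_eq_of_int_iff Z_adjoin_of_int)
    from zeta_red_minus_int[OF zeta_red_of_int this] have "int p dvd a - b"
      using zeta_red_0_iff[OF assms(1,2)] by blast
    then have "a mod int p = b mod int p" by (simp add: mod_eq_dvd_iff)
    with ab(1,2) show "a = b" by (simp add: carr)
  qed
  \<comment> \<open>Shifts \<open>c\<close> by a multiple of \<open>p\<close> into the range on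
    which \<open>to_GF\<close> inverts.\<close>
  have "zeta_red z 0 (c mod int p - c)"
    unfolding zeta_red_0_iff[OF assms(1,2)] by (simp add: mod_eq_dvd_iff[symmetric])
  from red_add[OF assms(3) this] have "zeta_red z x (c mod int p)" by simp
  then have "residue_class z x = residue_class z (of_int (c mod int p))"
    using zeta_red_imp_Z_adjoin[OF assms(3)] by (simp add: residue_class_eq_of_int_iff)
  moreover have "c mod int p \<in> carrier (GF p)" using p0 by (simp add: carr)
  ultimately show ?thesis unfolding to_GF_def using inv_into_f_f[OF inj] by simp
qed

section \<open>Inverses of \<open>q\<close>-integers and the residue of
  \<open>omega_q\<close>\<close>

lemma inverse_q_int:
  assumes "z ^ p = 1" "z ^ m \<noteq> 1" "[m * n = 1] (mod p)"
  shows "1 / q_int z m = (\<Sum>i<n. (z ^ m) ^ i)"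
proof -
  have z1: "z \<noteq> 1" using assms(2) by auto
  \<comment> \<open>Exponents of \<open>z\<close> matter only modulo \<open>p\<close>, which gives
    \<open>z ^ (m * n) = z\<close> below.\<close>
  have period: "z ^ j = z ^ (j mod p)" for j
  proof -
    have "z ^ j = z ^ (p * (j div p) + j mod p)" by simp
    also have "\<dots> = z ^ (j mod p)" by (simp only: power_add power_mult assms(1) power_one mult_1)
    finally show ?thesis .
  qed
  have "z ^ (m * n) = z ^ 1" using assms(3) by (metis period cong_def)
  then have "(\<Sum>i<n. (z ^ m) ^ i) = (1 - z) / (1 - z ^ m)"
    using assms(2) by (simp add: sum_gp_strict power_mult)
  moreover have "q_int z m = (1 - z ^ m) / (1 - z)"
    using z1 by (simp add: q_int_def sum_gp_strict)
  ultimately show ?thesis by simp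
qed

lemma zeta_red_omega_q:
  assumes "prime p" "primitive_root_of_unity p z" "length ks \<ge> 2"
  shows "zeta_red z (omega_q p ks z) (omega_residue p ks)"
proof -
  interpret int_reduction "zeta_red z" by (rule int_reduction_zeta_red)
  have q: "zeta_red z (1 / q_int z m) (modular_inverse (int p) (int m))" if m: "0 < m" "m < p" for m
  proof -
    \<comment> \<open>The modular inverse is nonnegative, so it can count the terms of the geometric
      sum; each term reduces to 1, giving residue \<open>n\<close>.\<close>
    define n where "n = nat (modular_inverse (int p) (int m))"
    have n: "int n = modular_inverse (int p) (int m)"
      using m by (simp add: n_def modular_inverse_int_nonneg)
    have "[int (m * n) = int 1] (mod int p)"
      using cong_modular_inverse_prime[OF assms(1) m] by (simp add: n)
    then have "[m * n = 1] (mod p)" unfolding cong_int_iff .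
    then have e: "1 / q_int z m = (\<Sum>i<n. (z ^ m) ^ i)"
      using assms(2) m by (intro inverse_q_int) (auto simp: primitive_root_of_unity_def)
    have "zeta_red z (\<Sum>i<n. (z ^ m) ^ i) (\<Sum>i<n. (1 ^ m) ^ i)"
      by (intro red_sum red_power zeta_red_gen)
    then show ?thesis unfolding e by (simp add: n)
  qed
  \<comment> \<open>Numerators are powers of \<open>z\<close> and reduce to 1 for every exponent
    \<open>l\<close>.\<close>
  have "zeta_red z (z ^ l / q_int z m ^ k) (modular_inverse (int p) (int m) ^ k)"
    if "0 < m" "m < p" for m k l
    using red_mult[OF red_power[OF zeta_red_gen, of l] red_power[OF q[OF that], of k]]
    by (simp add: power_one_over)
  then show ?thesis
    unfolding omega_q_def omega_residue_def
    by (intro red_sum red_prod) (use compositions_nth_bounds assms(3) in force)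
qed

section \<open>Comparison in \<open>ring_A\<close>\<close>

lemma A_elem_closed:
  assumes "\<And>p. prime p \<Longrightarrow> a p \<in> carrier (GF p)"
  shows "A_elem a \<in> carrier ring_A"
proof -
  have "restrict a primes \<in> carrier (product_ring primes GF)" using assms by auto
  then show ?thesis unfolding ring_A_def A_elem_def FactRing_def A_RCOSETS_def'
    by (auto simp del: product_ring_simps)
qed

theorem theorem1p2:
  fixes ks :: "nat list" and \<zeta> :: "nat \<Rightarrow> complex"
  assumes "is_index ks" and "length ks \<ge> 2"
    and "\<And>p. prime p \<Longrightarrow> primitive_root_of_unity p (\<zeta> p)"
  shows "(\<forall>p. prime p \<longrightarrow> omega_q p ks (\<zeta> p) \<in> carrier (Z_adjoin (\<zeta> p)))
    \<and> A_elem (\<lambda>p. to_GF p (\<zeta> p) (residue_class (\<zeta> p) (omega_q p ks (\<zeta> p)))) = omega_A ks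
    \<and> omega_A ks \<in> carrier ring_A"
proof (intro conjI allI impI)
  note red = zeta_red_omega_q[OF _ assms(3) assms(2)]
  show "omega_q p ks (\<zeta> p) \<in> carrier (Z_adjoin (\<zeta> p))" if "prime p" for p
    using red[OF that that] by (rule zeta_red_imp_Z_adjoin)
  have "to_GF p (\<zeta> p) (residue_class (\<zeta> p) (omega_q p ks (\<zeta> p))) = rat_mod (omega p ks) p"
    if "prime p" for p
    using to_GF_residue_class[OF that assms(3)[OF that] red[OF that that]]
      rat_mod_omega[OF that assms(2)] by simp
  \<comment> \<open>The components agree at every prime, so the two restricted families are equal
    even before passing to the quotient.\<close>
  then show "A_elem (\<lambda>p. to_GF p (\<zeta> p) (residue_class (\<zeta> p) (omega_q p ks (\<zeta> p)))) = omega_A ks"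
    unfolding omega_A_def A_elem_def by (simp cong: restrict_cong)
  show "omega_A ks \<in> carrier ring_A"
    unfolding omega_A_def
    by (rule A_elem_closed)
      (auto simp: rat_mod_omega[OF _ assms(2)] residue_ring_def prime_gt_0_nat)
qed

end
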